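(* Let $n$ be sufficiently large, and let $p_1,\ldots,p_n$ be points picked uniformly and independently at random from $[0,1]^2$, revealed to a player one at a time in this order; the player knows $n$ in advance and must irrevocably decide, when $p_i$ is revealed (and without knowledge of later points), whether to pick it; exactly one point may be picked. For $i\le n$ let $P_i=\{p_1,\ldots,p_i\}$ and $P=P_n$. Consider the following strategy, with parameters $f=c\sqrt{n}\log n$ (for a constant $c>0$) and a radius $R$: ignore the first $n-f$ points, and then pick the first point $p_i$ with $i>n-f$ such that the disk $D_i$ of radius $R$ centered at $p_i$ (with respect to the torus distance) contains no point of $P_i$ other than $p_i$. Then there are a sufficiently large constant $c$ and a radius $R=\Theta(\sqrt{(\log n)/n})$ such that, with probability at least $1-O\bigl(\frac{\log^2 n}{\sqrt{n}}\bigr)$, the player picks a point whose cell in the Voronoi diagram of $P$ has area $\Omega(\nabla)$, where $\nabla=\frac{\log n}{n}$, while the largest cell in the Voronoi diagram of $P$ has area $O(\nabla)$. That is, the strategy is $O(1)$-competitive with the optimal choice made with full knowledge of $P$ (the site of the largest cell).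
   Context: All logarithms are natural. The unit square $[0,1]^2$ is considered with the torus topology: for $x,y\in[0,1]$ let $d_T(x,y)=\min(|x-y|,1-|x-y|)$, and for $p,q\in[0,1]^2$ the torus distance is $d_T(p,q)=\sqrt{d_T(p_1,q_1)^2+d_T(p_2,q_2)^2}$. All Voronoi diagrams are computed with respect to this torus distance and restricted to $[0,1]^2$; the cell of a site $p\in P$ is the set of points of $[0,1]^2$ whose torus distance to $p$ is at most their torus distance to every other site of $P$. The player's payoff is the area of the cell of the picked point in the final Voronoi diagram of all of $P$. *)

theory Defs
  imports "HOL-Probability.Probability" "HOL-Library.Landau_Symbols"
begin

definition unit_square :: "(real \<times> real) set" where
  "unit_square = {0..1} \<times> {0..1}"

definition torus_dist1 :: "real \<Rightarrow> real \<Rightarrow> real" where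
  "torus_dist1 x y = min \<bar>x - y\<bar> (1 - \<bar>x - y\<bar>)"

definition torus_dist :: "real \<times> real \<Rightarrow> real \<times> real \<Rightarrow> real" where
  "torus_dist p q = sqrt ((torus_dist1 (fst p) (fst q))\<^sup>2 + (torus_dist1 (snd p) (snd q))\<^sup>2)"

definition voronoi_cell :: "(real \<times> real) set \<Rightarrow> real \<times> real \<Rightarrow> (real \<times> real) set" where
  "voronoi_cell S q = {x \<in> unit_square. \<forall>r\<in>S. torus_dist x q \<le> torus_dist x r}"

definition cell_area :: "(real \<times> real) set \<Rightarrow> real \<times> real \<Rightarrow> real" where
  "cell_area S q = measure lborel (voronoi_cell S q)"

text \<open>The probability space of n i.i.d. uniform points; point p_(i+1) is \<omega> i, i < n.\<close>
definition points_space :: "nat \<Rightarrow> (nat \<Rightarrow> real \<times> real) measure" where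
  "points_space n = PiM {..<n} (\<lambda>_. uniform_measure lborel unit_square)"

definition point_set :: "nat \<Rightarrow> (nat \<Rightarrow> real \<times> real) \<Rightarrow> (real \<times> real) set" where
  "point_set n \<omega> = \<omega> ` {..<n}"

text \<open>Index i (0-based, i.e. the point p_(i+1)) is acceptable for the strategy with
  f = c sqrt n ln n and radius R: it comes after the first n - f points and the closed
  torus disk of radius R around it contains no earlier point.\<close>
definition strategy_ok :: "nat \<Rightarrow> real \<Rightarrow> real \<Rightarrow> (nat \<Rightarrow> real \<times> real) \<Rightarrow> nat \<Rightarrow> bool" where
  "strategy_ok n c R \<omega> i \<longleftrightarrow>
     i < n \<and> real (i + 1) > real n - c * sqrt (real n) * ln (real n) \<and>
     (\<forall>j<i. torus_dist (\<omega> j) (\<omega> i) > R)"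

definition strategy_pick :: "nat \<Rightarrow> real \<Rightarrow> real \<Rightarrow> (nat \<Rightarrow> real \<times> real) \<Rightarrow> nat option" where
  "strategy_pick n c R \<omega> =
     (if \<exists>i. strategy_ok n c R \<omega> i then Some (LEAST i. strategy_ok n c R \<omega> i) else None)"

end

theory Submission
  imports Defs "HOL-Real_Asymp.Real_Asymp"
begin

text \<open>
  Cut the square into a grid with cells of area of order \<open>ln n / n\<close>. By the second moment method
  (emptiness of distinct cells is negatively correlated) a fraction of at least \<open>n powr (- 1/4) / 2\<close>
  of the cells of a suitable grid is still empty after the ignored points, up to an error
  probability below \<open>ln\<^sup>2 n / sqrt n\<close>. The middle thirds of these cells are far from all ignored
  points, so with high probability one of the last \<open>c sqrt n ln n\<close> points hits the region \<open>U\<close> of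
  points not covered by the ignored ones. The first hit of \<open>U\<close> is the pick unless one of the other last points falls
  into its disk. For each index \<open>j\<close> this has probability \<open>O(R\<^sup>2)\<close>, since the first hit among the
  indices other than \<open>j\<close> is independent of the \<open>j\<close>-th point; hence the union bound over \<open>j\<close> costs
  \<open>O(sqrt n ln n \<sqdot> ln n / n)\<close>. An empty disk of radius \<open>R\<close> forces a cell of area \<open>\<Omega>(R\<^sup>2)\<close>. The
  largest cell is small because a coarser grid has no empty cell with high probability.
\<close>

section \<open>Resampling one coordinate of a product measure\<close>

text \<open>Tonelli, with coordinate \<open>j\<close> integrated first. By \<open>inv\<close> each
  fibre in direction \<open>j\<close> lies entirely in \<open>B\<close> or misses \<open>B\<close>,
  and then also \<open>A\<close>. In the first case \<open>A\<close> takes at most the share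
  \<open>b\<close> of the fibre. This is the only form of independence used for the points after the
  ignored ones: \<open>B\<close> describes what the other points do, \<open>b\<close> bounds the
  conditional probability for the point with index \<open>j\<close>.\<close>

lemma (in product_prob_space) measure_PiM_resample_le:
  assumes fin: "finite I" and j: "j \<in> I"
    and A[measurable]: "A \<in> sets (PiM I M)" and B[measurable]: "B \<in> sets (PiM I M)"
    and AB: "A \<subseteq> B"
    and inv: "\<And>w y. w \<in> B \<Longrightarrow> y \<in> space (M j) \<Longrightarrow> w(j := y) \<in> B"
    and bound: "\<And>w. w \<in> B \<Longrightarrow> measure (M j) {y \<in> space (M j). w(j := y) \<in> A} \<le> b"
    and b: "b \<ge> 0"
  shows "measure (PiM I M) A \<le> b * measure (PiM I M) B"
proof -
  let ?J = "I - {j}"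
  have I: "I = insert j ?J" using j by auto
  have upd: "x(j := y) \<in> space (PiM I M)" if "x \<in> space (PiM ?J M)" "y \<in> space (M j)" for x y
    using that j by (auto simp: space_PiM PiE_iff extensional_def)
  have inner: "(\<integral>\<^sup>+ y. indicator A (x(j := y)) \<partial>M j) \<le> (\<integral>\<^sup>+ y. ennreal b * indicator B (x(j := y)) \<partial>M j)"
    if x: "x \<in> space (PiM ?J M)" for x
  proof (cases "\<exists>y\<in>space (M j). x(j := y) \<in> B")
    case True
    then obtain y0 where y0: "y0 \<in> space (M j)" "x(j := y0) \<in> B" by auto
    have allB: "x(j := y) \<in> B" if "y \<in> space (M j)" for y
      using inv[OF y0(2) that] by simp
    have meas[measurable]: "(\<lambda>y. x(j := y)) \<in> M j \<rightarrow>\<^sub>M PiM I M"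
      using x j by (intro measurable_fun_upd[where J = ?J]) auto
    have "(\<integral>\<^sup>+ y. indicator A (x(j := y)) \<partial>M j) = (\<integral>\<^sup>+ y. indicator {y \<in> space (M j). x(j := y) \<in> A} y \<partial>M j)"
      by (intro nn_integral_cong) (auto split: split_indicator)
    also have "\<dots> = emeasure (M j) {y \<in> space (M j). x(j := y) \<in> A}"
      by (rule nn_integral_indicator) measurable
    also have "\<dots> \<le> ennreal b"
      using bound[OF y0(2)] by (simp add: M.emeasure_eq_measure b)
    also have "\<dots> = (\<integral>\<^sup>+ y. ennreal b \<partial>M j)"
      by (simp add: M.emeasure_space_1)
    also have "\<dots> = (\<integral>\<^sup>+ y. ennreal b * indicator B (x(j := y)) \<partial>M j)"
      by (intro nn_integral_cong) (auto simp: allB)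
    finally show ?thesis .
  next
    case False
    then have "(\<integral>\<^sup>+ y. indicator A (x(j := y)) \<partial>M j) = (\<integral>\<^sup>+ y. 0 \<partial>M j)"
      using AB by (intro nn_integral_cong) (auto split: split_indicator)
    then show ?thesis by simp
  qed
  have split: "(\<integral>\<^sup>+ w. f w \<partial>PiM I M) = (\<integral>\<^sup>+ x. \<integral>\<^sup>+ y. f (x(j := y)) \<partial>M j \<partial>PiM ?J M)"
    if "f \<in> borel_measurable (PiM I M)" for f
    using product_nn_integral_insert[of ?J j f] that fin I by auto
  have "emeasure (PiM I M) A = (\<integral>\<^sup>+ w. indicator A w \<partial>PiM I M)" by simp
  also have "\<dots> \<le> (\<integral>\<^sup>+ w. ennreal b * indicator B w \<partial>PiM I M)"
    by (subst (1 2) split) (auto intro!: nn_integral_mono inner)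
  also have "\<dots> = ennreal b * emeasure (PiM I M) B"
    by (simp add: nn_integral_cmult)
  finally show ?thesis
    using b by (simp add: P.emeasure_eq_measure ennreal_mult[symmetric])
qed

section \<open>The uniform distribution on the square and independent samples\<close>

abbreviation uniform_square :: "(real \<times> real) measure" where
  "uniform_square \<equiv> uniform_measure lborel unit_square"

lemma sets_unit_square[measurable]: "unit_square \<in> sets borel"
  unfolding unit_square_def borel_prod[symmetric] by measurable

lemma emeasure_lborel_Times:
  assumes "A \<in> sets borel" "B \<in> sets borel"
  shows "emeasure lborel (A \<times> B :: (real \<times> real) set) = emeasure lborel A * emeasure lborel B"
  using assms unfolding lborel_prod[symmetric]
  by (subst lborel.emeasure_pair_measure_Times) auto

lemma measure_lborel_Times:
  assumes "A \<in> sets borel" "B \<in> sets borel"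
  shows "measure lborel (A \<times> B :: (real \<times> real) set) = measure lborel A * measure lborel B"
  using assms by (simp add: measure_def emeasure_lborel_Times enn2real_mult)

lemma emeasure_unit_square: "emeasure lborel unit_square = 1"
  by (simp add: unit_square_def emeasure_lborel_Times)

lemma measure_unit_square: "measure lborel unit_square = 1"
  by (simp add: measure_def emeasure_unit_square)

interpretation unif: prob_space uniform_square
  by (rule prob_space_uniform_measure) (auto simp: emeasure_unit_square)

interpretation unifs: product_prob_space "\<lambda>_::nat. uniform_square" I for I
  by unfold_locales

lemma measure_uniform_square:
  assumes "S \<in> sets borel" shows "measure uniform_square S = measure lborel (unit_square \<inter> S)"
  using assms by (subst measure_uniform_measure) (auto simp: emeasure_unit_square measure_unit_square)

interpretation pts: prob_space "points_space n" for n
  unfolding points_space_def by unfold_locales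

text \<open>Points with index at least \<open>n\<close> are constantly \<open>undefined\<close>, so no bound on \<open>i\<close> is required.\<close>
lemma measurable_point[measurable]: "(\<lambda>\<omega>. \<omega> i) \<in> points_space n \<rightarrow>\<^sub>M borel"
proof (cases "i < n")
  case True
  then have "(\<lambda>\<omega>. \<omega> i) \<in> points_space n \<rightarrow>\<^sub>M uniform_square"
    unfolding points_space_def by (intro measurable_component_singleton) auto
  then show ?thesis by (simp cong: measurable_cong_sets)
next
  case False
  then have *: "\<omega> i = undefined" if "\<omega> \<in> space (points_space n)" for \<omega>
    using that unfolding points_space_def space_PiM by (intro PiE_arb) auto
  show ?thesis
    by (subst measurable_cong[OF *]) auto
qed

lemma prob_avoid:
  assumes S: "S \<in> sets borel" and m: "m \<le> n"
  shows "measure (points_space n) {\<omega> \<in> space (points_space n). \<forall>j<m. \<omega> j \<notin> S}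
    = (1 - measure uniform_square S) ^ m"
proof -
  have "emeasure (points_space n) {\<omega> \<in> space (points_space n). \<forall>j\<in>{..<m}. \<omega> j \<in> - S}
    = (\<Prod>j\<in>{..<m}. emeasure uniform_square (- S))"
    unfolding points_space_def using S m
    by (intro unifs.emeasure_PiM_Collect) auto
  also have "\<dots> = ennreal (measure uniform_square (- S) ^ m)"
    by (simp add: unif.emeasure_eq_measure ennreal_power)
  also have "measure uniform_square (- S) = 1 - measure uniform_square S"
    using unif.prob_compl[of S] S by (simp add: Compl_eq_Diff_UNIV)
  finally show ?thesis
    using unif.prob_le_1[of S]
    by (simp add: pts.emeasure_eq_measure Ball_def del: emeasure_uniform_measure measure_uniform_measure)
qed

section \<open>Torus distance and areas of Voronoi cells\<close>

lemma torus_dist1_le_abs: "torus_dist1 x y \<le> \<bar>x - y\<bar>"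
  by (simp add: torus_dist1_def)

lemma torus_dist1_nonneg: "x \<in> {0..1} \<Longrightarrow> y \<in> {0..1} \<Longrightarrow> 0 \<le> torus_dist1 x y"
  by (auto simp: torus_dist1_def)

lemma torus_dist1_triangle:
  "x \<in> {0..1} \<Longrightarrow> y \<in> {0..1} \<Longrightarrow> z \<in> {0..1} \<Longrightarrow> torus_dist1 x z \<le> torus_dist1 x y + torus_dist1 y z"
  unfolding torus_dist1_def by (auto simp: min_def abs_if)

lemma torus_dist_commute: "torus_dist p q = torus_dist q p"
  by (simp add: torus_dist_def torus_dist1_def abs_minus_commute)

lemma torus_dist_eq_norm:
  "torus_dist p q = norm (torus_dist1 (fst p) (fst q), torus_dist1 (snd p) (snd q))"
  by (simp add: torus_dist_def norm_Pair)

lemma torus_dist_ge_components: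
  "\<bar>torus_dist1 (fst p) (fst q)\<bar> \<le> torus_dist p q" "\<bar>torus_dist1 (snd p) (snd q)\<bar> \<le> torus_dist p q"
  by (simp_all add: torus_dist_def)

lemma torus_dist_le_sum:
  "torus_dist p q \<le> \<bar>torus_dist1 (fst p) (fst q)\<bar> + \<bar>torus_dist1 (snd p) (snd q)\<bar>"
  unfolding torus_dist_def by (rule sqrt_sum_squares_le_sum_abs)

lemma torus_dist_le:
  assumes "p \<in> unit_square" "q \<in> unit_square"
    "\<bar>fst p - fst q\<bar> \<le> d" "\<bar>snd p - snd q\<bar> \<le> d"
  shows "torus_dist p q \<le> 2 * d"
  using torus_dist_le_sum[of p q] torus_dist1_le_abs[of "fst p" "fst q"] torus_dist1_le_abs[of "snd p" "snd q"]
    torus_dist1_nonneg[of "fst p" "fst q"] torus_dist1_nonneg[of "snd p" "snd q"] assms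
  by (auto simp: unit_square_def mem_Times_iff)

lemma torus_dist_triangle:
  assumes "p \<in> unit_square" "q \<in> unit_square" "r \<in> unit_square"
  shows "torus_dist p r \<le> torus_dist p q + torus_dist q r"
proof -
  let ?d = "\<lambda>p q. (torus_dist1 (fst p) (fst q), torus_dist1 (snd p) (snd q))"
  have "torus_dist p r \<le> norm (?d p q + ?d q r)"
    unfolding torus_dist_def norm_Pair plus_prod_def using assms
    by (auto intro!: real_sqrt_le_mono add_mono power_mono torus_dist1_triangle torus_dist1_nonneg
        simp: unit_square_def mem_Times_iff)
  also have "\<dots> \<le> torus_dist p q + torus_dist q r"
    unfolding torus_dist_eq_norm by (rule norm_triangle_ineq)
  finally show ?thesis .
qed

lemma borel_measurable_torus_dist[measurable (raw)]:
  assumes [measurable]: "f \<in> M \<rightarrow>\<^sub>M borel" "g \<in> M \<rightarrow>\<^sub>M borel"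
  shows "(\<lambda>x. torus_dist (f x) (g x)) \<in> borel_measurable M"
proof -
  have [measurable]: "fst \<in> borel_measurable (borel :: (real \<times> real) measure)"
    "snd \<in> borel_measurable (borel :: (real \<times> real) measure)"
    by (simp_all add: borel_measurable_continuous_onI continuous_on_fst continuous_on_snd)
  show ?thesis unfolding torus_dist_def torus_dist1_def by measurable
qed

lemma measure_torus_ball_le:
  assumes q: "q \<in> unit_square" and r: "r \<ge> 0"
  shows "measure lborel {x \<in> unit_square. torus_dist x q \<le> r} \<le> 36 * r\<^sup>2"
proof -
  \<comment> \<open>A torus interval of radius \<open>r\<close> around \<open>a\<close>, unrolled to
    the line: the interval around \<open>a\<close> and its translates by -1 and 1. The three pieces
    have total length \<open>6 * r\<close>, which is the source of the constant 36.\<close>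
  define T where "T a = {a - r..a + r} \<union> ({a - 1 - r..a - 1 + r} \<union> {a + 1 - r..a + 1 + r})" for a :: real
  have T[measurable]: "T a \<in> sets borel" for a by (simp add: T_def)
  have fin: "T a \<in> fmeasurable lborel" for a
    unfolding T_def by (intro fmeasurable.Un) (auto simp: fmeasurable_def emeasure_lborel_Icc_eq)
  have mT: "measure lborel (T a) \<le> 6 * r" for a
  proof -
    have "measure lborel (T a) \<le> measure lborel {a - r..a + r} +
        measure lborel ({a - 1 - r..a - 1 + r} \<union> {a + 1 - r..a + 1 + r})"
      unfolding T_def by (rule measure_Un_le) auto
    also have "measure lborel ({a - 1 - r..a - 1 + r} \<union> {a + 1 - r..a + 1 + r}) \<le>
       measure lborel {a - 1 - r..a - 1 + r} + measure lborel {a + 1 - r..a + 1 + r}"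
      by (rule measure_Un_le) auto
    finally show ?thesis using r by simp
  qed
  have mem: "x \<in> T a" if "x \<in> {0..1}" "a \<in> {0..1}" "torus_dist1 x a \<le> r" for x a
    using that r unfolding T_def torus_dist1_def min_le_iff_disj by (auto simp: abs_le_iff split: abs_split)
  have "{x \<in> unit_square. torus_dist x q \<le> r} \<subseteq> T (fst q) \<times> T (snd q)"
  proof
    fix x assume "x \<in> {x \<in> unit_square. torus_dist x q \<le> r}"
    then show "x \<in> T (fst q) \<times> T (snd q)"
      using torus_dist_ge_components[of x q] mem[of "fst x" "fst q"] mem[of "snd x" "snd q"] q
      by (auto simp: mem_Times_iff unit_square_def)
  qed
  moreover have "T (fst q) \<times> T (snd q) \<in> fmeasurable lborel"
    using fmeasurableD2[OF fin] unfolding fmeasurable_def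
    by (auto simp: emeasure_lborel_Times ennreal_mult_less_top less_top borel_prod[symmetric])
  moreover have "{x \<in> unit_square. torus_dist x q \<le> r} \<in> sets lborel"
    by measurable
  ultimately have "measure lborel {x \<in> unit_square. torus_dist x q \<le> r} \<le> measure lborel (T (fst q) \<times> T (snd q))"
    by (intro measure_mono_fmeasurable)
  also have "\<dots> = measure lborel (T (fst q)) * measure lborel (T (snd q))"
    by (simp add: measure_lborel_Times)
  also have "\<dots> \<le> (6 * r) * (6 * r)"
    by (intro mult_mono mT) (use r in auto)
  finally show ?thesis by (simp add: power2_eq_square)
qed

text \<open>A point of the cell is no farther from \<open>q\<close> than from the site within
  distance \<open>d\<close> that \<open>cover\<close> supplies, so the cell lies in the torus disk
  of radius \<open>d\<close> around \<open>q\<close>.\<close>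

lemma cell_area_le:
  assumes q: "q \<in> unit_square" and d: "d \<ge> 0"
    and cover: "\<And>x. x \<in> unit_square \<Longrightarrow> \<exists>r\<in>S. torus_dist x r \<le> d"
    and S: "finite S"
  shows "cell_area S q \<le> 36 * d\<^sup>2"
proof -
  have "voronoi_cell S q \<in> sets lborel"
    unfolding voronoi_cell_def using S by measurable
  moreover have "voronoi_cell S q \<subseteq> {x \<in> unit_square. torus_dist x q \<le> d}"
    using cover unfolding voronoi_cell_def by (force intro: order_trans)
  moreover have "{x \<in> unit_square. torus_dist x q \<le> d} \<in> fmeasurable lborel"
    by (rule fmeasurableI2[of unit_square]) (auto simp: fmeasurable_def emeasure_unit_square)
  ultimately have "cell_area S q \<le> measure lborel {x \<in> unit_square. torus_dist x q \<le> d}"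
    unfolding cell_area_def by (intro measure_mono_fmeasurable)
  then show ?thesis using measure_torus_ball_le[OF q d] by simp
qed

text \<open>The cell contains an axis-parallel square of side \<open>r\<close> with corner
  \<open>q\<close>: its points are within \<open>2 * r\<close> of \<open>q\<close>, and by the
  triangle inequality at least \<open>2 * r\<close> away from every other site.\<close>

lemma cell_area_ge:
  assumes S: "finite S" "S \<subseteq> unit_square" and r: "0 \<le> r" "r \<le> 1 / 2"
    and q: "q \<in> unit_square"
    and sep: "\<And>p. p \<in> S \<Longrightarrow> p \<noteq> q \<Longrightarrow> 4 * r \<le> torus_dist p q"
  shows "r\<^sup>2 \<le> cell_area S q"
proof -
  \<comment> \<open>\<open>{a t..a t + r}\<close> has \<open>t\<close> as one endpoint and extends
    towards the farther end of the unit interval. As \<open>r\<close> is at most 1/2, it stays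
    inside, so the square is never cut off by the boundary.\<close>
  define a where "a t = (if t \<le> 1 / 2 then t else t - r)" for t
  have a: "x \<in> {0..1}" "\<bar>x - t\<bar> \<le> r" if "x \<in> {a t..a t + r}" "t \<in> {0..1}" for x t
    using that r by (auto simp: a_def split: if_splits)
  let ?B = "{a (fst q)..a (fst q) + r} \<times> {a (snd q)..a (snd q) + r}"
  have "?B \<subseteq> voronoi_cell S q"
  proof
    fix x assume x: "x \<in> ?B"
    have xs: "x \<in> unit_square"
      using x q a[of "fst x" "fst q"] a[of "snd x" "snd q"] by (auto simp: unit_square_def mem_Times_iff)
    have d: "torus_dist x q \<le> 2 * r"
      using x q a[of "fst x" "fst q"] a[of "snd x" "snd q"]
      by (intro torus_dist_le xs) (auto simp: mem_Times_iff unit_square_def)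
    have "torus_dist x q \<le> torus_dist x p" if "p \<in> S" for p
    proof (cases "p = q")
      case False
      have "4 * r \<le> torus_dist p x + torus_dist x q"
        using sep[OF that False] torus_dist_triangle[of p x q] S that xs q by auto
      then show ?thesis using d by (simp add: torus_dist_commute[of p x])
    qed simp
    then show "x \<in> voronoi_cell S q" using xs by (auto simp: voronoi_cell_def)
  qed
  moreover have "voronoi_cell S q \<in> fmeasurable lborel"
  proof (rule fmeasurableI2[of unit_square])
    show "voronoi_cell S q \<in> sets lborel" unfolding voronoi_cell_def using S by measurable
  qed (auto simp: fmeasurable_def emeasure_unit_square voronoi_cell_def)
  ultimately have "measure lborel ?B \<le> cell_area S q"
    unfolding cell_area_def by (intro measure_mono_fmeasurable) (auto simp: borel_prod[symmetric])
  moreover have "measure lborel ?B = r\<^sup>2"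
    using r by (simp add: measure_lborel_Times power2_eq_square)
  ultimately show ?thesis by simp
qed

section \<open>Grid cells and their middle thirds\<close>

text \<open>Half-open intervals make distinct cells disjoint. The cost is that points with a
  coordinate equal to 1 lie in no cell of the grid.\<close>

definition grid_cell :: "nat \<Rightarrow> nat \<times> nat \<Rightarrow> (real \<times> real) set" where
  "grid_cell k b = {real (fst b) / real k..<(real (fst b) + 1) / real k} \<times>
     {real (snd b) / real k..<(real (snd b) + 1) / real k}"

definition grid_core :: "nat \<Rightarrow> nat \<times> nat \<Rightarrow> (real \<times> real) set" where
  "grid_core k b = {(real (fst b) + 1/3) / real k..(real (fst b) + 2/3) / real k} \<times>
     {(real (snd b) + 1/3) / real k..(real (snd b) + 2/3) / real k}"

abbreviation grid :: "nat \<Rightarrow> (nat \<times> nat) set" where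
  "grid k \<equiv> {..<k} \<times> {..<k}"

definition empty_cells :: "nat \<Rightarrow> nat \<Rightarrow> (nat \<Rightarrow> real \<times> real) \<Rightarrow> (nat \<times> nat) set" where
  "empty_cells k m \<omega> = {b \<in> grid k. \<forall>j<m. \<omega> j \<notin> grid_cell k b}"

definition free_region :: "nat \<Rightarrow> nat \<Rightarrow> (nat \<Rightarrow> real \<times> real) \<Rightarrow> (real \<times> real) set" where
  "free_region k m \<omega> = (\<Union>b\<in>empty_cells k m \<omega>. grid_core k b)"

lemma sets_grid_cell[measurable]: "grid_cell k b \<in> sets borel"
  unfolding grid_cell_def borel_prod[symmetric] by measurable

lemma sets_grid_core[measurable]: "grid_core k b \<in> sets borel"
  unfolding grid_core_def borel_prod[symmetric] by measurable

lemma finite_empty_cells: "finite (empty_cells k m \<omega>)"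
  by (rule finite_subset[of _ "grid k"]) (auto simp: empty_cells_def)

lemma sets_free_region[measurable]: "free_region k m \<omega> \<in> sets borel"
  unfolding free_region_def using finite_empty_cells by (intro sets.finite_UN) auto

lemma unit_interval_grid:
  fixes k a :: nat and x :: real
  assumes "a < k" "x \<in> {real a / real k..(real a + 1) / real k}"
  shows "x \<in> {0..1}"
proof -
  have "x \<le> (real a + 1) / real k" "0 \<le> real a / real k" "real a + 1 \<le> real k" using assms by auto
  moreover then have "(real a + 1) / real k \<le> 1" by (simp add: field_simps)
  ultimately show ?thesis using assms unfolding atLeastAtMost_iff by linarith
qed

lemma grid_cell_subset: "b \<in> grid k \<Longrightarrow> grid_cell k b \<subseteq> unit_square"
  unfolding grid_cell_def unit_square_def using unit_interval_grid by fastforce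

lemma grid_core_subset: "b \<in> grid k \<Longrightarrow> grid_core k b \<subseteq> grid_cell k b"
  by (auto simp: grid_core_def grid_cell_def field_simps)

lemma measure_grid_cell:
  assumes "b \<in> grid k" shows "measure uniform_square (grid_cell k b) = 1 / (real k)\<^sup>2"
proof -
  have "measure uniform_square (grid_cell k b) = measure lborel (grid_cell k b)"
    using grid_cell_subset[OF assms] by (simp add: measure_uniform_square Int_absorb1 del: measure_uniform_measure)
  also have "\<dots> = 1 / (real k)\<^sup>2"
    unfolding grid_cell_def
    by (simp add: measure_lborel_Times divide_right_mono power2_eq_square diff_divide_distrib[symmetric])
  finally show ?thesis .
qed

lemma measure_grid_core:
  assumes "b \<in> grid k" shows "measure uniform_square (grid_core k b) = 1 / (9 * (real k)\<^sup>2)"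
proof -
  have "measure uniform_square (grid_core k b) = measure lborel (grid_core k b)"
    using grid_core_subset[OF assms] grid_cell_subset[OF assms]
    by (subst measure_uniform_square) (auto intro!: arg_cong[where f = "measure lborel"])
  also have "\<dots> = 1 / (9 * (real k)\<^sup>2)"
    unfolding grid_core_def
    by (simp add: measure_lborel_Times divide_right_mono power2_eq_square diff_divide_distrib[symmetric])
  finally show ?thesis .
qed

lemma grid_interval_unique:
  fixes a b k :: nat and x :: real
  assumes "real a / real k \<le> x" "x < (real a + 1) / real k" "real b / real k \<le> x" "x < (real b + 1) / real k"
  shows "a = b"
proof -
  have k: "real k > 0" using assms(1,2) by (cases "k = 0") auto
  then have "real a < real b + 1" "real b < real a + 1"
    using assms by (auto simp: field_simps)
  then show ?thesis by linarith
qed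

lemma grid_cell_disjoint: "b \<noteq> b' \<Longrightarrow> grid_cell k b \<inter> grid_cell k b' = {}"
  using grid_interval_unique[of "fst b" k _ "fst b'"] grid_interval_unique[of "snd b" k _ "snd b'"]
  by (auto simp: grid_cell_def prod_eq_iff)

lemma measure_free_region:
  "measure uniform_square (free_region k m \<omega>) = real (card (empty_cells k m \<omega>)) / (9 * (real k)\<^sup>2)"
proof -
  have "measure uniform_square (free_region k m \<omega>) = (\<Sum>b\<in>empty_cells k m \<omega>. measure uniform_square (grid_core k b))"
    unfolding free_region_def
  proof (rule unif.finite_measure_finite_Union[OF finite_empty_cells])
    show "disjoint_family_on (grid_core k) (empty_cells k m \<omega>)"
      unfolding disjoint_family_on_def
    proof (intro ballI impI)
      fix b b' assume "b \<in> empty_cells k m \<omega>" "b' \<in> empty_cells k m \<omega>" "b \<noteq> b'"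
      then show "grid_core k b \<inter> grid_core k b' = {}"
        using grid_cell_disjoint[of b b' k] grid_core_subset[of b k] grid_core_subset[of b' k]
        unfolding empty_cells_def by blast
    qed
  qed auto
  also have "\<dots> = (\<Sum>b\<in>empty_cells k m \<omega>. 1 / (9 * (real k)\<^sup>2))"
    by (intro sum.cong refl measure_grid_core) (auto simp: empty_cells_def)
  finally show ?thesis by simp
qed

text \<open>This handles the wraparound: if \<open>x\<close> keeps this margin from 0 and 1, then
  \<open>1 - \<bar>x - y\<bar>\<close> is at least the margin for every \<open>y\<close> in the unit
  interval.\<close>

lemma grid_core_margin:
  assumes "b \<in> grid k" "p \<in> grid_core k b"
  shows "fst p \<in> {1 / (3 * real k)..1 - 1 / (3 * real k)}" "snd p \<in> {1 / (3 * real k)..1 - 1 / (3 * real k)}"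
proof -
  have *: "x \<in> {1 / (3 * real k)..1 - 1 / (3 * real k)}"
    if "a < k" "x \<in> {(real a + 1/3) / real k..(real a + 2/3) / real k}" for a x
  proof -
    have "(1/3) / real k \<le> (real a + 1/3) / real k" "(real a + 2/3) / real k \<le> (real k - 1/3) / real k"
      using that by (intro divide_right_mono; simp)+
    moreover have "(real k - 1/3) / real k = 1 - 1 / (3 * real k)" using that by (simp add: field_simps)
    ultimately show ?thesis using that by (auto simp: field_simps)
  qed
  show "fst p \<in> {1 / (3 * real k)..1 - 1 / (3 * real k)}" "snd p \<in> {1 / (3 * real k)..1 - 1 / (3 * real k)}"
    using assms *[of "fst b"] *[of "snd b"] by (auto simp: grid_core_def mem_Times_iff simp del: atLeastAtMost_iff)
qed

text \<open>Some coordinate of \<open>r\<close> lies outside the interval of the cell, hence at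
  least a third of the side length away from the core in the ordinary distance. The way around the
  torus is at least as long by \<open>grid_core_margin\<close>.\<close>

lemma torus_dist_grid_core:
  assumes b: "b \<in> grid k" and p: "p \<in> grid_core k b" and r: "r \<in> unit_square" "r \<notin> grid_cell k b"
  shows "1 / (3 * real k) \<le> torus_dist r p"
proof -
  have *: "1 / (3 * real k) \<le> torus_dist1 y x"
    if "a < k" "x \<in> {(real a + 1/3) / real k..(real a + 2/3) / real k}"
      "x \<in> {1 / (3 * real k)..1 - 1 / (3 * real k)}" "y \<in> {0..1}"
      "y \<notin> {real a / real k..<(real a + 1) / real k}" for a x y
  proof -
    have "real a / real k + 1 / (3 * real k) = (real a + 1/3) / real k"
      by (simp add: add_divide_distrib)
    also have "\<dots> \<le> x" using that(2) by simp
    finally have lo: "real a / real k + 1 / (3 * real k) \<le> x" .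
    have "x + 1 / (3 * real k) \<le> (real a + 2/3) / real k + 1 / (3 * real k)" using that(2) by simp
    also have "\<dots> = (real a + 1) / real k" using that(1) by (simp add: divide_simps)
    finally have hi: "x + 1 / (3 * real k) \<le> (real a + 1) / real k" .
    show ?thesis using lo hi that(3-5) by (auto simp: torus_dist1_def)
  qed
  consider "fst r \<notin> {real (fst b) / real k..<(real (fst b) + 1) / real k}"
    | "snd r \<notin> {real (snd b) / real k..<(real (snd b) + 1) / real k}"
    using r(2) by (auto simp: grid_cell_def mem_Times_iff)
  then show ?thesis
  proof cases
    case 1
    then have "1 / (3 * real k) \<le> torus_dist1 (fst r) (fst p)"
      using b p r grid_core_margin[OF b p]
      by (intro *[of "fst b"]) (auto simp: grid_core_def unit_square_def mem_Times_iff)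
    then show ?thesis using torus_dist_ge_components(1)[of r p] by simp
  next
    case 2
    then have "1 / (3 * real k) \<le> torus_dist1 (snd r) (snd p)"
      using b p r grid_core_margin[OF b p]
      by (intro *[of "snd b"]) (auto simp: grid_core_def unit_square_def mem_Times_iff)
    then show ?thesis using torus_dist_ge_components(2)[of r p] by simp
  qed
qed

text \<open>Every point of the square, including those with a coordinate equal to 1, lies in the
  closure of some cell of the grid, and within a closed cell each coordinate varies by at most
  \<open>1 / real k\<close>.\<close>

lemma grid_cell_cover:
  assumes k: "k > 0" and x: "x \<in> unit_square"
  obtains b where "b \<in> grid k" "\<And>p. p \<in> grid_cell k b \<Longrightarrow> torus_dist x p \<le> 2 / real k"
proof -
  have *: "\<exists>a<k. t \<in> {real a / real k..(real a + 1) / real k}" if t: "t \<in> {0..1}" for t :: real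
  proof (cases "t = 1")
    case True
    then show ?thesis using k by (intro exI[of _ "k - 1"]) (auto simp: field_simps of_nat_diff)
  next
    case False
    have fl: "real_of_int \<lfloor>t * real k\<rfloor> \<le> t * real k" "t * real k < real_of_int \<lfloor>t * real k\<rfloor> + 1"
      "0 \<le> \<lfloor>t * real k\<rfloor>" using t by auto
    have "t * real k < real k" using False t k by auto
    then have "real (nat \<lfloor>t * real k\<rfloor>) < real k" using fl by linarith
    then show ?thesis using fl k
      by (intro exI[of _ "nat \<lfloor>t * real k\<rfloor>"]) (auto simp: field_simps)
  qed
  obtain a where a: "a < k" "fst x \<in> {real a / real k..(real a + 1) / real k}"
    using * x by (auto simp: unit_square_def mem_Times_iff)
  obtain c where c: "c < k" "snd x \<in> {real c / real k..(real c + 1) / real k}"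
    using * x by (auto simp: unit_square_def mem_Times_iff)
  have b: "(a, c) \<in> grid k" using a c by auto
  have "torus_dist x p \<le> 2 / real k" if p: "p \<in> grid_cell k (a, c)" for p
  proof -
    have "torus_dist x p \<le> 2 * (1 / real k)"
      using x p grid_cell_subset[OF b] a c
      by (intro torus_dist_le) (auto simp: grid_cell_def mem_Times_iff add_divide_distrib abs_le_iff)
    then show ?thesis by simp
  qed
  with b show ?thesis by (rule that)
qed

section \<open>Lower tail of the number of empty cells\<close>

text \<open>\<open>\<mu>\<close> is the expected number of empty cells. Negative correlation of the
  emptiness events bounds the variance by \<open>\<mu>\<close>, and Chebyshev's inequality for a
  deviation of \<open>\<mu> / 2\<close> gives \<open>4 / \<mu>\<close>.\<close>

lemma prob_few_empty_cells:
  assumes k: "k \<ge> 2" and m: "m \<le> n"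
  defines "\<mu> \<equiv> (real k)\<^sup>2 * (1 - 1 / (real k)\<^sup>2) ^ m"
  shows "measure (points_space n) {\<omega> \<in> space (points_space n). real (card (empty_cells k m \<omega>)) < \<mu> / 2} \<le> 4 / \<mu>"
proof -
  define q where "q = (1 - 1 / (real k)\<^sup>2) ^ m"
  define Z where "Z b = {\<omega> \<in> space (points_space n). \<forall>j<m. \<omega> j \<notin> grid_cell k b}" for b
  define X where "X \<omega> = (\<Sum>b\<in>grid k. indicator (Z b) \<omega> :: real)" for \<omega>
  have k2: "(real k)\<^sup>2 \<ge> 4" using power_mono[of 2 "real k" 2] k by simp
  have \<mu>: "\<mu> = (real k)\<^sup>2 * q" by (simp add: \<mu>_def q_def)
  have q: "q > 0" using k2 unfolding q_def by (intro zero_less_power) (auto simp: divide_less_eq)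
  have \<mu>0: "\<mu> > 0" unfolding \<mu> using q k by (intro mult_pos_pos) auto
  have Z[measurable]: "Z b \<in> sets (points_space n)" for b
    unfolding Z_def by measurable
  have X[measurable]: "X \<in> borel_measurable (points_space n)" unfolding X_def by measurable
  have pZ: "measure (points_space n) (Z b) = q" if "b \<in> grid k" for b
    unfolding Z_def q_def using that m by (subst prob_avoid) (auto simp: measure_grid_cell simp del: measure_uniform_measure)
  have pZZ: "measure (points_space n) (Z b \<inter> Z b') \<le> q\<^sup>2" if "b \<in> grid k" "b' \<in> grid k" "b \<noteq> b'" for b b'
  proof -
    have "Z b \<inter> Z b' = {\<omega> \<in> space (points_space n). \<forall>j<m. \<omega> j \<notin> grid_cell k b \<union> grid_cell k b'}"
      by (auto simp: Z_def)
    then have "measure (points_space n) (Z b \<inter> Z b') = (1 - measure uniform_square (grid_cell k b \<union> grid_cell k b')) ^ m"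
      using m by (simp only: prob_avoid[OF sets.Un[OF sets_grid_cell sets_grid_cell]])
    also have "measure uniform_square (grid_cell k b \<union> grid_cell k b') = 2 / (real k)\<^sup>2"
    proof -
      have "measure uniform_square (grid_cell k b \<union> grid_cell k b')
          = measure uniform_square (grid_cell k b) + measure uniform_square (grid_cell k b')"
        using grid_cell_disjoint[OF that(3)] by (intro unif.finite_measure_Union) auto
      then show ?thesis by (simp only: measure_grid_cell[OF that(1)] measure_grid_cell[OF that(2)])
    qed
    \<comment> \<open>The negative correlation: for two disjoint cells of measure \<open>x\<close>
      each, \<open>1 - 2 * x\<close> is at most \<open>(1 - x)\<^sup>2\<close>.\<close>
    also have "(1 - 2 / (real k)\<^sup>2) ^ m \<le> ((1 - 1 / (real k)\<^sup>2)\<^sup>2) ^ m"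
    proof (intro power_mono)
      have "1 / (real k)\<^sup>2 \<le> 1 / 4" using k k2 by (intro divide_left_mono) auto
      then show "0 \<le> 1 - 2 / (real k)\<^sup>2" by simp
      show "1 - 2 / (real k)\<^sup>2 \<le> (1 - 1 / (real k)\<^sup>2)\<^sup>2" by (simp add: power2_diff)
    qed
    also have "\<dots> = q\<^sup>2" unfolding q_def by (simp only: power_mult[symmetric] mult.commute)
    finally show ?thesis .
  qed
  have int: "integrable (points_space n) (indicator A :: _ \<Rightarrow> real)" if "A \<in> sets (points_space n)" for A
    using that by (simp add: pts.emeasure_eq_measure)
  have EX: "(LINT \<omega>|points_space n. X \<omega>) = \<mu>"
  proof -
    have "(LINT \<omega>|points_space n. X \<omega>) = (\<Sum>b\<in>grid k. measure (points_space n) (Z b))"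
      unfolding X_def by (subst Bochner_Integration.integral_sum) (auto intro!: int)
    also have "\<dots> = \<mu>" by (simp add: pZ \<mu> power2_eq_square)
    finally show ?thesis .
  qed
  have X2: "(X \<omega>)\<^sup>2 = (\<Sum>b\<in>grid k. \<Sum>b'\<in>grid k. indicator (Z b \<inter> Z b') \<omega>)" for \<omega>
    unfolding X_def power2_eq_square sum_product by (simp add: indicator_inter_arith)
  have iX2: "integrable (points_space n) (\<lambda>\<omega>. (X \<omega>)\<^sup>2)"
    unfolding X2 by (intro Bochner_Integration.integrable_sum int sets.Int Z)
  have iX: "integrable (points_space n) X"
    unfolding X_def by (intro Bochner_Integration.integrable_sum int Z)
  have EX2: "(LINT \<omega>|points_space n. (X \<omega>)\<^sup>2) \<le> \<mu> + \<mu>\<^sup>2"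
  proof -
    have "(LINT \<omega>|points_space n. (X \<omega>)\<^sup>2) = (\<Sum>b\<in>grid k. \<Sum>b'\<in>grid k. measure (points_space n) (Z b \<inter> Z b'))"
      unfolding X2
    proof (subst Bochner_Integration.integral_sum)
      show "(\<Sum>b\<in>grid k. LINT \<omega>|points_space n. (\<Sum>b'\<in>grid k. indicator (Z b \<inter> Z b') \<omega>))
        = (\<Sum>b\<in>grid k. \<Sum>b'\<in>grid k. measure (points_space n) (Z b \<inter> Z b'))"
        by (intro sum.cong refl, subst Bochner_Integration.integral_sum)
          (simp_all add: int sets.Int[OF Z Z] Z Int_absorb2 sets.sets_into_space[OF sets.Int[OF Z Z]])
    qed (intro Bochner_Integration.integrable_sum int sets.Int Z)
    \<comment> \<open>The diagonal pairs add up to \<open>\<mu>\<close>, and the terms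
      \<open>q\<^sup>2\<close> over all pairs to \<open>\<mu>\<^sup>2\<close>, which cancels against
      the squared expectation in the variance.\<close>
    also have "\<dots> \<le> (\<Sum>b\<in>grid k. \<Sum>b'\<in>grid k. (if b = b' then q else 0) + q\<^sup>2)"
    proof (intro sum_mono)
      fix b b' assume bb: "b \<in> grid k" "b' \<in> grid k"
      show "measure (points_space n) (Z b \<inter> Z b') \<le> (if b = b' then q else 0) + q\<^sup>2"
        using pZ[OF bb(1)] pZZ[OF bb] by (cases "b = b'") simp_all
    qed
    also have "\<dots> = \<mu> + \<mu>\<^sup>2"
      by (simp add: sum.distrib \<mu> power2_eq_square) (simp add: distrib_left mult.assoc mult.left_commute)
    finally show ?thesis .
  qed
  have var: "pts.variance n X \<le> \<mu>"
    using pts.variance_eq[OF iX iX2] EX2 unfolding EX by linarith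
  have "{\<omega> \<in> space (points_space n). real (card (empty_cells k m \<omega>)) < \<mu> / 2}
     \<subseteq> {\<omega> \<in> space (points_space n). \<mu> / 2 \<le> \<bar>X \<omega> - pts.expectation n X\<bar>}"
  proof clarify
    fix \<omega> assume \<omega>: "\<omega> \<in> space (points_space n)" "real (card (empty_cells k m \<omega>)) < \<mu> / 2"
    have "X \<omega> = (\<Sum>b\<in>grid k. if b \<in> empty_cells k m \<omega> then 1 else 0)"
      unfolding X_def using \<omega>(1) by (intro sum.cong refl) (auto simp: Z_def empty_cells_def indicator_def)
    also have "\<dots> = real (card (empty_cells k m \<omega>))"
      by (subst sum.inter_restrict[symmetric]) (simp_all add: empty_cells_def Int_def)
    finally show "\<mu> / 2 \<le> \<bar>X \<omega> - pts.expectation n X\<bar>" using \<omega>(2) EX by simp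
  qed
  then have "measure (points_space n) {\<omega> \<in> space (points_space n). real (card (empty_cells k m \<omega>)) < \<mu> / 2}
     \<le> measure (points_space n) {\<omega> \<in> space (points_space n). \<mu> / 2 \<le> \<bar>X \<omega> - pts.expectation n X\<bar>}"
    by (intro pts.finite_measure_mono) measurable
  also have "\<dots> \<le> pts.variance n X / (\<mu> / 2)\<^sup>2"
    using \<mu>0 by (intro pts.Chebyshev_inequality iX2) auto
  also have "\<dots> \<le> \<mu> / (\<mu> / 2)\<^sup>2"
    using var by (intro divide_right_mono) auto
  also have "\<dots> = 4 / \<mu>" using \<mu>0 by (simp add: power2_eq_square)
  finally show ?thesis .
qed

section \<open>Hitting the cores of the empty cells\<close>

lemma measurable_empty_cells[measurable]:
  "(\<lambda>\<omega>. real (card (empty_cells k m \<omega>))) \<in> borel_measurable (points_space n)"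
proof -
  have "real (card (empty_cells k m \<omega>)) = (\<Sum>b\<in>grid k. if \<forall>j<m. \<omega> j \<notin> grid_cell k b then 1 else 0)" for \<omega>
    unfolding empty_cells_def by (subst sum.inter_filter[symmetric]) auto
  then show ?thesis by simp
qed

lemma pred_free_region[measurable]:
  "Measurable.pred (points_space n) (\<lambda>\<omega>. \<omega> i \<in> free_region k m \<omega>)"
proof -
  have "\<omega> i \<in> free_region k m \<omega> \<longleftrightarrow> (\<exists>b\<in>grid k. (\<forall>j<m. \<omega> j \<notin> grid_cell k b) \<and> \<omega> i \<in> grid_core k b)" for \<omega>
    by (auto simp: free_region_def empty_cells_def)
  then show ?thesis by simp
qed

lemma free_region_upd: "m \<le> j \<Longrightarrow> free_region k m (w(j := y)) = free_region k m w"
  unfolding free_region_def empty_cells_def by (intro arg_cong[where f = "\<lambda>E. \<Union>b\<in>E. grid_core k b"]) auto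

lemma space_points_upd: "w \<in> space (points_space n) \<Longrightarrow> j < n \<Longrightarrow> w(j := y) \<in> space (points_space n)"
  by (auto simp: points_space_def space_PiM PiE_iff extensional_def)

text \<open>The quotient is the measure of the free region by \<open>measure_free_region\<close>.
  The region depends on the first \<open>m\<close> points only, so each later point misses it with
  conditional probability at most \<open>1 - u\<close>. The induction resamples the point with index
  \<open>m + l\<close>.\<close>

lemma prob_miss_free_region:
  assumes "m + l \<le> n" "0 \<le> u" "u \<le> 1"
  shows "measure (points_space n) {\<omega> \<in> space (points_space n).
      u \<le> real (card (empty_cells k m \<omega>)) / (9 * (real k)\<^sup>2) \<and> (\<forall>i<m + l. m \<le> i \<longrightarrow> \<omega> i \<notin> free_region k m \<omega>)} \<le> (1 - u) ^ l"
  using assms(1)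
proof (induction l)
  case 0
  then show ?case by simp
next
  case (Suc l)
  let ?S = "\<lambda>l. {\<omega> \<in> space (points_space n).
      u \<le> real (card (empty_cells k m \<omega>)) / (9 * (real k)\<^sup>2) \<and> (\<forall>i<m + l. m \<le> i \<longrightarrow> \<omega> i \<notin> free_region k m \<omega>)}"
  have card: "real (card (empty_cells k m \<omega>)) / (9 * (real k)\<^sup>2) = measure uniform_square (free_region k m \<omega>)" for \<omega>
    by (rule measure_free_region[symmetric])
  have [measurable]: "?S l \<in> sets (points_space n)" for l
    by measurable
  have "measure (points_space n) (?S (Suc l)) \<le> (1 - u) * measure (points_space n) (?S l)"
    unfolding points_space_def
  proof (rule unifs.measure_PiM_resample_le[where j = "m + l"], unfold points_space_def[symmetric])
    fix w assume w: "w \<in> ?S l"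
    show "w(m + l := y) \<in> ?S l" for y
      using w Suc.prems by (auto simp: card free_region_upd space_points_upd simp del: measure_uniform_measure)
    have "measure uniform_square {y \<in> space uniform_square. w(m + l := y) \<in> ?S (Suc l)}
      \<le> measure uniform_square (- free_region k m w)"
      by (intro unif.finite_measure_mono) (auto simp: free_region_upd)
    also have "\<dots> = 1 - measure uniform_square (free_region k m w)"
      using unif.prob_compl[of "free_region k m w"] by (simp add: Compl_eq_Diff_UNIV del: measure_uniform_measure)
    also have "\<dots> \<le> 1 - u" using w by (simp add: card del: measure_uniform_measure)
    finally show "measure uniform_square {y \<in> space uniform_square. w(m + l := y) \<in> ?S (Suc l)} \<le> 1 - u" .
  qed (use Suc.prems assms in auto)
  also have "\<dots> \<le> (1 - u) * (1 - u) ^ l"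
    using Suc assms by (intro mult_left_mono) auto
  finally show ?case by simp
qed

section \<open>The uncovered region and its first hit\<close>

definition uncovered :: "real \<Rightarrow> nat \<Rightarrow> (nat \<Rightarrow> real \<times> real) \<Rightarrow> (real \<times> real) set" where
  "uncovered R m \<omega> = {p \<in> unit_square. \<forall>j<m. R < torus_dist (\<omega> j) p}"

lemma uncovered_upd: "m \<le> j \<Longrightarrow> uncovered R m (w(j := y)) = uncovered R m w"
  by (auto simp: uncovered_def)

lemma uncovered_subset: "uncovered R m \<omega> \<subseteq> unit_square"
  by (auto simp: uncovered_def)

lemma pred_uncovered[measurable]:
  "Measurable.pred (points_space n) (\<lambda>\<omega>. \<omega> i \<in> uncovered R m \<omega>)"
  unfolding uncovered_def mem_Collect_eq by measurable

text \<open>The free region has a computable area, while the strategy reacts to the uncovered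
  region. The inclusion turns a hit of the former into a hit of the latter: a core of an empty cell
  is at least \<open>1 / (3 * real k)\<close> away from all of the first \<open>m\<close>
  points.\<close>

lemma free_region_subset_uncovered:
  assumes "\<And>j. j < m \<Longrightarrow> \<omega> j \<in> unit_square" "R < 1 / (3 * real k)"
  shows "free_region k m \<omega> \<subseteq> uncovered R m \<omega>"
proof
  fix p assume "p \<in> free_region k m \<omega>"
  then obtain b where b: "b \<in> grid k" "\<And>j. j < m \<Longrightarrow> \<omega> j \<notin> grid_cell k b" "p \<in> grid_core k b"
    by (auto simp: free_region_def empty_cells_def)
  have "R < torus_dist (\<omega> j) p" if "j < m" for j
    using torus_dist_grid_core[OF b(1,3) assms(1)[OF that] b(2)[OF that]] assms(2) by simp
  moreover have "p \<in> unit_square"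
    using b grid_core_subset[OF b(1)] grid_cell_subset[OF b(1)] by auto
  ultimately show "p \<in> uncovered R m \<omega>" by (auto simp: uncovered_def)
qed

text \<open>Leaving out the index \<open>j\<close> makes the first hit independent of the point with that index.\<close>
definition first_hit :: "real \<Rightarrow> nat \<Rightarrow> nat \<Rightarrow> nat \<Rightarrow> (nat \<Rightarrow> real \<times> real) \<Rightarrow> nat \<Rightarrow> bool" where
  "first_hit R m n j \<omega> i \<longleftrightarrow> i \<in> {m..<n} - {j} \<and> \<omega> i \<in> uncovered R m \<omega> \<and>
     (\<forall>i'\<in>{m..<i} - {j}. \<omega> i' \<notin> uncovered R m \<omega>)"

lemma first_hit_unique: "first_hit R m n j \<omega> i \<Longrightarrow> first_hit R m n j \<omega> i' \<Longrightarrow> i = i'"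
  unfolding first_hit_def by (metis DiffD2 DiffI atLeastLessThan_iff DiffD1 linorder_neqE_nat)

lemma first_hit_upd: "m \<le> j \<Longrightarrow> first_hit R m n j (w(j := y)) i \<longleftrightarrow> first_hit R m n j w i"
  by (auto simp: first_hit_def uncovered_upd)

lemma pred_first_hit[measurable]:
  "Measurable.pred (points_space n) (\<lambda>\<omega>. first_hit R m n j \<omega> i)"
  unfolding first_hit_def by measurable

text \<open>Neither the index nor the position of the first hit changes when the point with index
  \<open>j\<close> is resampled. With the other points fixed, that point has to fall into one fixed
  torus disk of radius \<open>R\<close>.\<close>

lemma prob_near_first_hit:
  assumes j: "m \<le> j" "j < n" and R: "R \<ge> 0"
  shows "measure (points_space n) {\<omega> \<in> space (points_space n).
      \<exists>i<n. first_hit R m n j \<omega> i \<and> torus_dist (\<omega> j) (\<omega> i) \<le> R} \<le> 36 * R\<^sup>2"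
proof -
  let ?A = "{\<omega> \<in> space (points_space n). \<exists>i<n. first_hit R m n j \<omega> i \<and> torus_dist (\<omega> j) (\<omega> i) \<le> R}"
  have "measure (points_space n) ?A \<le> 36 * R\<^sup>2 * measure (points_space n) (space (points_space n))"
    unfolding points_space_def
  proof (rule unifs.measure_PiM_resample_le[where j = j], unfold points_space_def[symmetric])
    show "?A \<in> sets (points_space n)" by measurable
    fix w assume w: "w \<in> space (points_space n)"
    show "w(j := y) \<in> space (points_space n)" for y
      using w j by (intro space_points_upd)
    show "measure uniform_square {y \<in> space uniform_square. w(j := y) \<in> ?A} \<le> 36 * R\<^sup>2"
    proof (cases "\<exists>i. first_hit R m n j w i")
      case False
      then have "{y \<in> space uniform_square. w(j := y) \<in> ?A} = {}"
        using first_hit_upd[OF j(1)] by auto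
      then show ?thesis using R by (simp only:) simp
    next
      case True
      then obtain i where i: "first_hit R m n j w i" by auto
      then have wi: "w i \<in> unit_square" using uncovered_subset by (auto simp: first_hit_def)
      have "{y \<in> space uniform_square. w(j := y) \<in> ?A} \<subseteq> {y. torus_dist y (w i) \<le> R}"
      proof
        fix y assume "y \<in> {y \<in> space uniform_square. w(j := y) \<in> ?A}"
        then obtain i' where i': "first_hit R m n j (w(j := y)) i'" "torus_dist y ((w(j := y)) i') \<le> R"
          by auto
        have "i' = i" using i' i first_hit_unique by (auto simp: first_hit_upd[OF j(1)])
        moreover have "i \<noteq> j" using i by (auto simp: first_hit_def)
        ultimately show "y \<in> {y. torus_dist y (w i) \<le> R}" using i' by simp
      qed
      then have "measure uniform_square {y \<in> space uniform_square. w(j := y) \<in> ?A}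
        \<le> measure uniform_square {y. torus_dist y (w i) \<le> R}"
        by (intro unif.finite_measure_mono) auto
      also have "\<dots> = measure lborel {x \<in> unit_square. torus_dist x (w i) \<le> R}"
        by (subst measure_uniform_square) (auto intro!: arg_cong[where f = "measure lborel"])
      also have "\<dots> \<le> 36 * R\<^sup>2" by (rule measure_torus_ball_le[OF wi R])
      finally show ?thesis .
    qed
  qed (use j in auto)
  then show ?thesis by (simp add: pts.prob_space)
qed

section \<open>Measurability of the success event\<close>

text \<open>The cell is the section at \<open>\<omega>\<close> of a measurable subset
  \<open>Q\<close> of the product of the sample space with the plane, and the measure of a section
  depends measurably on the base point.\<close>

lemma measurable_cell_area:
  "(\<lambda>\<omega>. cell_area (point_set n \<omega>) (\<omega> i)) \<in> borel_measurable (points_space n)"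
proof -
  define Q where "Q = {z \<in> space (points_space n \<Otimes>\<^sub>M lborel). snd z \<in> unit_square \<and>
    (\<forall>j<n. torus_dist (snd z) (fst z i) \<le> torus_dist (snd z) (fst z j))}"
  have Q: "Q \<in> sets (points_space n \<Otimes>\<^sub>M lborel)"
  proof -
    have [measurable]: "(\<lambda>z. fst z j) \<in> points_space n \<Otimes>\<^sub>M lborel \<rightarrow>\<^sub>M borel" for j
      by (rule measurable_compose[OF measurable_fst measurable_point])
    have [measurable]: "snd \<in> points_space n \<Otimes>\<^sub>M (lborel :: (real \<times> real) measure) \<rightarrow>\<^sub>M borel"
      using measurable_snd[of "points_space n" "lborel :: (real \<times> real) measure"]
      by (simp cong: measurable_cong_sets)
    show ?thesis unfolding Q_def by measurable
  qed
  have "cell_area (point_set n \<omega>) (\<omega> i) = enn2real (emeasure lborel (Pair \<omega> -` Q))"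
    if "\<omega> \<in> space (points_space n)" for \<omega>
    unfolding cell_area_def measure_def
    by (rule arg_cong[where f = "\<lambda>S. enn2real (emeasure lborel S)"])
      (use that in \<open>auto simp: voronoi_cell_def point_set_def Q_def space_pair_measure\<close>)
  then show ?thesis
    using lborel.measurable_emeasure_Pair[OF Q] by (simp cong: measurable_cong)
qed

lemma strategy_pick_eq_Some:
  "strategy_pick n c R \<omega> = Some i \<longleftrightarrow> strategy_ok n c R \<omega> i \<and> (\<forall>i'<i. \<not> strategy_ok n c R \<omega> i')"
proof
  assume "strategy_pick n c R \<omega> = Some i"
  then have "\<exists>i. strategy_ok n c R \<omega> i" "i = (LEAST i. strategy_ok n c R \<omega> i)"
    by (auto simp: strategy_pick_def split: if_splits)
  then show "strategy_ok n c R \<omega> i \<and> (\<forall>i'<i. \<not> strategy_ok n c R \<omega> i')"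
    by (auto intro: LeastI_ex dest: not_less_Least)
next
  assume i: "strategy_ok n c R \<omega> i \<and> (\<forall>i'<i. \<not> strategy_ok n c R \<omega> i')"
  then have "(LEAST i. strategy_ok n c R \<omega> i) = i"
    by (intro Least_equality) (auto simp: not_less[symmetric])
  then show "strategy_pick n c R \<omega> = Some i" using i by (auto simp: strategy_pick_def)
qed

lemma sets_strategy_success:
  "{\<omega> \<in> space (points_space n).
     (\<exists>i. strategy_pick n c R \<omega> = Some i \<and> cell_area (point_set n \<omega>) (\<omega> i) \<ge> t1) \<and>
     (\<forall>j<n. cell_area (point_set n \<omega>) (\<omega> j) \<le> t2)} \<in> sets (points_space n)" (is "?S \<in> _")
proof -
  note measurable_cell_area[measurable]
  have [measurable]: "Measurable.pred (points_space n) (\<lambda>\<omega>. strategy_ok n c R \<omega> i)" for i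
    unfolding strategy_ok_def by measurable
  \<comment> \<open>Acceptable indices are below \<open>n\<close>, so the choice of \<open>i\<close>
    ranges over a finite set.\<close>
  have "?S = {\<omega> \<in> space (points_space n).
     (\<exists>i<n. strategy_ok n c R \<omega> i \<and> (\<forall>i'<i. \<not> strategy_ok n c R \<omega> i') \<and> cell_area (point_set n \<omega>) (\<omega> i) \<ge> t1) \<and>
     (\<forall>j<n. cell_area (point_set n \<omega>) (\<omega> j) \<le> t2)}"
    by (auto simp: strategy_pick_eq_Some strategy_ok_def)
  also have "\<dots> \<in> sets (points_space n)" by measurable
  finally show ?thesis .
qed

section \<open>Success outside the bad events\<close>

text \<open>The deterministic core. The pick is the first index from \<open>m\<close> on whose point
  is uncovered. The assumption \<open>far\<close> is stated with \<open>j\<close> left out of the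
  search, which matches the event of \<open>prob_near_first_hit\<close>.\<close>

lemma strategy_success:
  fixes n m k1 k2 :: nat
  assumes sq: "\<And>i. i < n \<Longrightarrow> \<omega> i \<in> unit_square"
    and full: "\<And>b. b \<in> grid k2 \<Longrightarrow> \<exists>j<n. \<omega> j \<in> grid_cell k2 b" and k2: "k2 > 0"
    and hit: "\<exists>i\<in>{m..<n}. \<omega> i \<in> free_region k1 m \<omega>"
    and far: "\<And>i j. j \<in> {m..<n} \<Longrightarrow> first_hit R m n j \<omega> i \<Longrightarrow> R < torus_dist (\<omega> j) (\<omega> i)"
    and R: "0 < R" "R < 1 / (3 * real k1)"
    and m: "\<And>i. real (i + 1) > real n - c * sqrt (real n) * ln (real n) \<longleftrightarrow> m \<le> i"
  shows "\<exists>i. strategy_pick n c R \<omega> = Some i \<and> R\<^sup>2 / 16 \<le> cell_area (point_set n \<omega>) (\<omega> i)"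
    and "j < n \<Longrightarrow> cell_area (point_set n \<omega>) (\<omega> j) \<le> 144 / (real k2)\<^sup>2"
proof -
  have P: "finite (point_set n \<omega>)" "point_set n \<omega> \<subseteq> unit_square"
    using sq by (auto simp: point_set_def)
  have "\<exists>i. i \<in> {m..<n} \<and> \<omega> i \<in> uncovered R m \<omega>"
    using hit free_region_subset_uncovered[of m \<omega> R k1] sq R by force
  then obtain i where i: "i \<in> {m..<n}" "\<omega> i \<in> uncovered R m \<omega>"
    and before: "\<And>i'. i' < i \<Longrightarrow> \<not> (i' \<in> {m..<n} \<and> \<omega> i' \<in> uncovered R m \<omega>)"
    using exists_least_iff[of "\<lambda>i. i \<in> {m..<n} \<and> \<omega> i \<in> uncovered R m \<omega>"] by blast
  \<comment> \<open>The first hit \<open>i\<close> is also the first hit when any \<open>j\<close>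
    different from \<open>i\<close> is left out. Points with \<open>j < i\<close> matter for
    accepting \<open>i\<close>; those after \<open>i\<close> matter for the area of the final
    cell.\<close>
  have sep: "R < torus_dist (\<omega> j) (\<omega> i)" if "j < n" "j \<noteq> i" for j
  proof (cases "j < m")
    case True
    then show ?thesis using i(2) by (auto simp: uncovered_def)
  next
    case False
    then show ?thesis using that i before by (intro far) (auto simp: first_hit_def)
  qed
  have "strategy_ok n c R \<omega> i"
    unfolding strategy_ok_def using m[of i] i sep by auto
  \<comment> \<open>No index before \<open>i\<close> is accepted, since an acceptable point avoids
    the disks around the first \<open>m\<close> points in particular and is thus uncovered.\<close>
  moreover have "\<not> strategy_ok n c R \<omega> i'" if "i' < i" for i'
  proof
    assume ok: "strategy_ok n c R \<omega> i'"
    then have "m \<le> i'" "i' < n" using m[of i'] by (auto simp: strategy_ok_def)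
    then have "\<omega> i' \<in> uncovered R m \<omega>" using ok sq by (auto simp: strategy_ok_def uncovered_def)
    then show False using before[OF that] \<open>m \<le> i'\<close> \<open>i' < n\<close> by simp
  qed
  ultimately have "strategy_pick n c R \<omega> = Some i" by (simp add: strategy_pick_eq_Some)
  moreover have "(R / 4)\<^sup>2 \<le> cell_area (point_set n \<omega>) (\<omega> i)"
  proof (rule cell_area_ge[OF P])
    have "real k1 \<ge> 1" using R by (cases "k1 = 0") auto
    then have "1 / (3 * real k1) \<le> 1" by (simp add: divide_le_eq)
    then show "R / 4 \<le> 1 / 2" using R by simp
    fix p assume "p \<in> point_set n \<omega>" "p \<noteq> \<omega> i"
    then obtain j where "j < n" "p = \<omega> j" "j \<noteq> i" by (auto simp: point_set_def)
    then show "4 * (R / 4) \<le> torus_dist p (\<omega> i)" using sep by fastforce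
  qed (use R i sq in auto)
  ultimately show "\<exists>i. strategy_pick n c R \<omega> = Some i \<and> R\<^sup>2 / 16 \<le> cell_area (point_set n \<omega>) (\<omega> i)"
    by (auto simp: power_divide)
  assume j: "j < n"
  have "cell_area (point_set n \<omega>) (\<omega> j) \<le> 36 * (2 / real k2)\<^sup>2"
  proof (rule cell_area_le)
    fix x assume "x \<in> unit_square"
    then obtain b where "b \<in> grid k2" "\<And>p. p \<in> grid_cell k2 b \<Longrightarrow> torus_dist x p \<le> 2 / real k2"
      using grid_cell_cover[OF k2] by metis
    then show "\<exists>r\<in>point_set n \<omega>. torus_dist x r \<le> 2 / real k2"
      using full by (fastforce simp: point_set_def)
  qed (use j sq P in auto)
  then show "cell_area (point_set n \<omega>) (\<omega> j) \<le> 144 / (real k2)\<^sup>2" by (simp add: power_divide)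
qed

text \<open>Union bound over the events under which the hypotheses of
  \<open>strategy_success\<close> may fail; the four summands belong to \<open>E1\<close> to
  \<open>E4\<close> below, and \<open>E0\<close> is a null set.\<close>

lemma prob_strategy_success:
  fixes n m k1 k2 :: nat and c R :: real
  assumes mn: "m \<le> n" and k1: "k1 \<ge> 2" and k2: "k2 > 0"
    and R: "0 < R" "R < 1 / (3 * real k1)"
    and m: "\<And>i. real (i + 1) > real n - c * sqrt (real n) * ln (real n) \<longleftrightarrow> m \<le> i"
    and t: "t1 \<le> R\<^sup>2 / 16" "144 / (real k2)\<^sup>2 \<le> t2"
  defines "q \<equiv> (1 - 1 / (real k1)\<^sup>2) ^ m"
  shows "1 - ((real k2)\<^sup>2 * (1 - 1 / (real k2)\<^sup>2) ^ n + 4 / ((real k1)\<^sup>2 * q)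
      + (1 - q / 18) ^ (n - m) + real (n - m) * (36 * R\<^sup>2))
    \<le> measure (points_space n) {\<omega> \<in> space (points_space n).
     (\<exists>i. strategy_pick n c R \<omega> = Some i \<and> cell_area (point_set n \<omega>) (\<omega> i) \<ge> t1) \<and>
     (\<forall>j<n. cell_area (point_set n \<omega>) (\<omega> j) \<le> t2)}" (is "_ \<le> measure _ ?G")
proof -
  let ?M = "points_space n"
  \<comment> \<open>The samples range over the whole plane, so points outside the square have to be
    excluded as an event of probability 0.\<close>
  define E0 where "E0 = (\<Union>j\<in>{..<n}. {\<omega> \<in> space ?M. \<omega> j \<notin> unit_square})"
  define E1 where "E1 = (\<Union>b\<in>grid k2. {\<omega> \<in> space ?M. \<forall>j<n. \<omega> j \<notin> grid_cell k2 b})"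
  define E2 where "E2 = {\<omega> \<in> space ?M. real (card (empty_cells k1 m \<omega>)) < (real k1)\<^sup>2 * q / 2}"
  \<comment> \<open>Outside \<open>E2\<close> at least the fraction \<open>q / 2\<close> of the
    cells is empty. Each core has a ninth of the area of its cell, so the free region has measure at
    least \<open>q / 18\<close>.\<close>
  define E3 where "E3 = {\<omega> \<in> space ?M. q / 18 \<le> real (card (empty_cells k1 m \<omega>)) / (9 * (real k1)\<^sup>2) \<and>
     (\<forall>i<m + (n - m). m \<le> i \<longrightarrow> \<omega> i \<notin> free_region k1 m \<omega>)}"
  define E4 where "E4 = (\<Union>j\<in>{m..<n}. {\<omega> \<in> space ?M. \<exists>i<n. first_hit R m n j \<omega> i \<and> torus_dist (\<omega> j) (\<omega> i) \<le> R})"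
  have q: "0 \<le> q" "q \<le> 1"
    using k1 by (auto simp: q_def divide_le_eq intro!: zero_le_power power_le_one)
  have S0: "{\<omega> \<in> space ?M. \<omega> j \<notin> unit_square} \<in> sets ?M" for j
    by measurable
  have S1: "{\<omega> \<in> space ?M. \<forall>j<n. \<omega> j \<notin> grid_cell k2 b} \<in> sets ?M" for b
    by measurable
  have S4: "{\<omega> \<in> space ?M. \<exists>i<n. first_hit R m n j \<omega> i \<and> torus_dist (\<omega> j) (\<omega> i) \<le> R} \<in> sets ?M" for j
    by measurable
  have E: "E0 \<in> sets ?M" "E1 \<in> sets ?M" "E4 \<in> sets ?M"
    unfolding E0_def E1_def E4_def by (intro sets.finite_UN; simp add: S0 S1 S4)+
  have E': "E2 \<in> sets ?M" "E3 \<in> sets ?M"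
    unfolding E2_def E3_def by measurable
  have "measure ?M E0 \<le> (\<Sum>j\<in>{..<n}. measure ?M {\<omega> \<in> space ?M. \<omega> j \<notin> unit_square})"
    unfolding E0_def using S0 by (intro pts.finite_measure_subadditive_finite) auto
  also have "\<dots> = 0"
  proof (intro sum.neutral ballI)
    fix j assume "j \<in> {..<n}"
    then have "emeasure ?M {\<omega> \<in> space ?M. \<omega> j \<in> - unit_square} = emeasure uniform_square (- unit_square)"
      unfolding points_space_def by (intro unifs.emeasure_PiM_Collect_single) auto
    also have "\<dots> = 0" by (simp add: emeasure_unit_square)
    finally show "measure ?M {\<omega> \<in> space ?M. \<omega> j \<notin> unit_square} = 0" by (simp add: measure_def)
  qed
  finally have P0: "measure ?M E0 \<le> 0" .
  have "measure ?M E1 \<le> (\<Sum>b\<in>grid k2. measure ?M {\<omega> \<in> space ?M. \<forall>j<n. \<omega> j \<notin> grid_cell k2 b})"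
    unfolding E1_def using S1 by (intro pts.finite_measure_subadditive_finite) auto
  also have "\<dots> = (\<Sum>b\<in>grid k2. (1 - 1 / (real k2)\<^sup>2) ^ n)"
    by (intro sum.cong refl) (simp only: prob_avoid[OF sets_grid_cell order_refl] measure_grid_cell)
  finally have P1: "measure ?M E1 \<le> (real k2)\<^sup>2 * (1 - 1 / (real k2)\<^sup>2) ^ n"
    by (simp add: power2_eq_square)
  have P2: "measure ?M E2 \<le> 4 / ((real k1)\<^sup>2 * q)"
    unfolding E2_def q_def by (rule prob_few_empty_cells[OF k1 mn])
  have P3: "measure ?M E3 \<le> (1 - q / 18) ^ (n - m)"
    unfolding E3_def using mn q by (intro prob_miss_free_region) auto
  have "measure ?M E4 \<le> (\<Sum>j\<in>{m..<n}. measure ?M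
      {\<omega> \<in> space ?M. \<exists>i<n. first_hit R m n j \<omega> i \<and> torus_dist (\<omega> j) (\<omega> i) \<le> R})"
    unfolding E4_def using S4 by (intro pts.finite_measure_subadditive_finite) auto
  also have "\<dots> \<le> (\<Sum>j\<in>{m..<n}. 36 * R\<^sup>2)"
    using R by (intro sum_mono prob_near_first_hit) auto
  finally have P4: "measure ?M E4 \<le> real (n - m) * (36 * R\<^sup>2)" by simp
  have "space ?M - ?G \<subseteq> E0 \<union> E1 \<union> E2 \<union> E3 \<union> E4"
  proof (rule subsetI, rule ccontr)
    fix \<omega> assume \<omega>: "\<omega> \<in> space ?M - ?G" and not: "\<omega> \<notin> E0 \<union> E1 \<union> E2 \<union> E3 \<union> E4"
    have sp: "\<omega> \<in> space ?M" using \<omega> by simp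
    have sq: "\<omega> j \<in> unit_square" if "j < n" for j
      using not sp that by (auto simp: E0_def)
    have full: "\<exists>j<n. \<omega> j \<in> grid_cell k2 b" if "b \<in> grid k2" for b
      using not sp that unfolding E1_def by blast
    have "(real k1)\<^sup>2 * q / 2 \<le> real (card (empty_cells k1 m \<omega>))"
      using not sp by (auto simp: E2_def)
    then have "q / 18 \<le> real (card (empty_cells k1 m \<omega>)) / (9 * (real k1)\<^sup>2)"
      using k1 by (simp add: field_simps)
    then have hit: "\<exists>i\<in>{m..<n}. \<omega> i \<in> free_region k1 m \<omega>"
      using not sp mn by (auto simp: E3_def)
    have far: "R < torus_dist (\<omega> j) (\<omega> i)" if "j \<in> {m..<n}" "first_hit R m n j \<omega> i" for i j
    proof -
      have "i < n" using that(2) by (simp add: first_hit_def)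
      then show ?thesis using not sp that unfolding E4_def by force
    qed
    have "\<exists>i. strategy_pick n c R \<omega> = Some i \<and> R\<^sup>2 / 16 \<le> cell_area (point_set n \<omega>) (\<omega> i)"
      using sq full k2 hit far R m by (rule strategy_success(1))
    then obtain i where i: "strategy_pick n c R \<omega> = Some i" "R\<^sup>2 / 16 \<le> cell_area (point_set n \<omega>) (\<omega> i)"
      by blast
    have "t1 \<le> cell_area (point_set n \<omega>) (\<omega> i)" using t(1) i(2) by linarith
    moreover have "cell_area (point_set n \<omega>) (\<omega> j) \<le> t2" if "j < n" for j
    proof -
      have "cell_area (point_set n \<omega>) (\<omega> j) \<le> 144 / (real k2)\<^sup>2"
        using sq full k2 hit far R m that by (rule strategy_success(2))
      then show ?thesis using t(2) by linarith
    qed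
    ultimately have "\<omega> \<in> ?G" using sp i(1) by blast
    then show False using \<omega> by simp
  qed
  then have "measure ?M (space ?M - ?G) \<le> measure ?M (E0 \<union> E1 \<union> E2 \<union> E3 \<union> E4)"
    using E E' by (intro pts.finite_measure_mono) auto
  also have "\<dots> \<le> measure ?M E0 + measure ?M E1 + measure ?M E2 + measure ?M E3 + measure ?M E4"
    using E E' measure_Un_le[of E0 ?M E1] measure_Un_le[of "E0 \<union> E1" ?M E2]
      measure_Un_le[of "E0 \<union> E1 \<union> E2" ?M E3] measure_Un_le[of "E0 \<union> E1 \<union> E2 \<union> E3" ?M E4]
    by (simp add: sets.Un)
  finally have "measure ?M (space ?M - ?G) \<le> (real k2)\<^sup>2 * (1 - 1 / (real k2)\<^sup>2) ^ n + 4 / ((real k1)\<^sup>2 * q)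
      + (1 - q / 18) ^ (n - m) + real (n - m) * (36 * R\<^sup>2)"
    using P0 P1 P2 P3 P4 by linarith
  then show ?thesis
    using pts.prob_compl[OF sets_strategy_success[of n c R t1 t2]] by simp
qed

section \<open>Choice of the parameters and asymptotics\<close>

lemma power_one_minus_le_exp:
  fixes x :: real
  shows "0 \<le> x \<Longrightarrow> x \<le> 1 \<Longrightarrow> (1 - x) ^ k \<le> exp (- (real k * x))"
  using power_mono[of "1 - x" "exp (- x)" k] exp_ge_add_one_self[of "- x"]
  by (simp add: exp_of_nat_mult[symmetric])

lemma power_one_minus_ge_exp:
  fixes x :: real
  assumes "0 \<le> x" "x \<le> 1 / 2"
  shows "exp (- (2 * real k * x)) \<le> (1 - x) ^ k"
proof -
  have "x * x \<le> x * (1 / 2)" using assms by (intro mult_left_mono) auto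
  then have "1 \<le> (1 - x) * (1 + 2 * x)" by (simp add: algebra_simps)
  also have "\<dots> \<le> (1 - x) * exp (2 * x)"
    using assms exp_ge_add_one_self[of "2 * x"] by (intro mult_left_mono) auto
  finally have "exp (- (2 * x)) \<le> 1 - x"
    by (simp add: exp_minus field_simps)
  then have "exp (- (2 * x)) ^ k \<le> (1 - x) ^ k" by (intro power_mono) auto
  then show ?thesis by (simp add: exp_of_nat_mult[symmetric] algebra_simps)
qed

lemma prob_strategy_success_asymp:
  fixes n :: nat
  defines "l \<equiv> ln (real n)"
  assumes n: "l \<ge> 1" "16 * l \<le> real n" "18 * sqrt (real n) * l \<le> real n"
  shows "1 - 11 * l\<^sup>2 / sqrt (real n)
    \<le> measure (points_space n) {\<omega> \<in> space (points_space n).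
     (\<exists>i. strategy_pick n 18 (sqrt (l / real n) / 13) \<omega> = Some i \<and>
        cell_area (point_set n \<omega>) (\<omega> i) \<ge> 1 / 2704 * (l / real n)) \<and>
     (\<forall>j<n. cell_area (point_set n \<omega>) (\<omega> j) \<le> 2304 * (l / real n))}"
proof -
  \<comment> \<open>A cell of side \<open>1 / L\<close> has area \<open>l / real n\<close>. The fine
    grid \<open>k1\<close> must leave cells empty (\<open>3 * L \<le> real k1\<close>) and yet have
    cells large enough for the radius (\<open>real k1 \<le> 4 * L\<close>). The coarse grid
    \<open>k2\<close> must have no empty cell (\<open>real k2 \<le> L / 2\<close>) and still small
    cells (\<open>L / 4 \<le> real k2\<close>).\<close>
  define L where "L = sqrt (real n / l)"
  define k1 where "k1 = nat \<lfloor>4 * L\<rfloor>"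
  define k2 where "k2 = nat \<lfloor>L / 2\<rfloor>"
  \<comment> \<open>For the 0-based index \<open>i\<close>, the condition that \<open>i + 1\<close>
    exceeds this real number says that \<open>i\<close> is at least its floor, which is nonnegative
    by \<open>n(3)\<close>.\<close>
  define m where "m = nat \<lfloor>real n - 18 * sqrt (real n) * l\<rfloor>"
  \<comment> \<open>\<open>R = 1 / (13 * L)\<close>: any factor above 12 puts \<open>R\<close> below
    \<open>1 / (3 * real k1)\<close>.\<close>
  define R where "R = sqrt (l / real n) / 13"
  define q where "q = (1 - 1 / (real k1)\<^sup>2) ^ m"
  define s where "s = sqrt (sqrt (real n))"
  have n0: "real n \<ge> 16" using n by linarith
  have L2: "L\<^sup>2 = real n / l" using n by (simp add: L_def)
  have L4: "L \<ge> 4" unfolding L_def using n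
    by (intro real_le_rsqrt) (simp add: field_simps)
  have k1: "3 * L \<le> real k1" "real k1 \<le> 4 * L"
    unfolding k1_def using L4 by linarith+
  have k2: "L / 4 \<le> real k2" "real k2 \<le> L / 2"
    unfolding k2_def using L4 by linarith+
  have k1': "k1 \<ge> 2" and k2': "k2 > 0" using k1 k2 L4 by linarith+
  have s2: "s\<^sup>2 = sqrt (real n)" by (simp add: s_def)
  have s4: "(s\<^sup>2)\<^sup>2 = real n" by (simp add: s2)
  have s1: "s \<ge> 1" using n0 by (simp add: s_def)
  have ln_s: "exp (- (l / 4)) = 1 / s"
  proof -
    have "l = ln ((s\<^sup>2)\<^sup>2)" by (simp only: l_def s4)
    also have "\<dots> = 4 * ln s" using s1 by (simp add: ln_realpow)
    finally show ?thesis using s1 by (simp add: exp_minus inverse_eq_divide)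
  qed
  have K1: "9 * L\<^sup>2 \<le> (real k1)\<^sup>2" using power_mono[OF k1(1), of 2] L4 by (simp add: power_mult_distrib)
  have K2: "L\<^sup>2 / 16 \<le> (real k2)\<^sup>2" "(real k2)\<^sup>2 \<le> L\<^sup>2 / 4"
    using power_mono[OF k2(1), of 2] power_mono[OF k2(2), of 2] L4 by (simp_all add: power_divide)
  have L2': "L\<^sup>2 \<ge> 16" using power_mono[OF L4, of 2] by simp
  \<comment> \<open>Rounding makes \<open>n - m\<close> exceed this quantity by less than 1, so
    doubling it gives the upper bound in \<open>nm\<close>.\<close>
  have f1: "18 * sqrt (real n) * l \<ge> 1"
    using mult_mono[of 1 "sqrt (real n)" 1 l] n n0 by simp
  have m1: "real m \<le> real n - 18 * sqrt (real n) * l" "real n - 18 * sqrt (real n) * l < real m + 1"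
    unfolding m_def using n(3) by linarith+
  have mn: "m \<le> n" using m1 f1 by linarith
  have m_iff: "real (i + 1) > real n - 18 * sqrt (real n) * ln (real n) \<longleftrightarrow> m \<le> i" for i
    using m1 unfolding l_def[symmetric] by linarith
  have nm: "18 * sqrt (real n) * l \<le> real (n - m)" "real (n - m) \<le> 36 * sqrt (real n) * l"
    using m1 mn f1 by (auto simp: of_nat_diff)
  have R2: "R\<^sup>2 = l / real n / 169" using n by (simp add: R_def power_divide)
  have "R * L = 1 / 13"
    using n n0 by (simp add: R_def L_def real_sqrt_mult[symmetric])
  then have R: "0 < R" "R < 1 / (3 * real k1)"
  proof -
    show "0 < R" using n n0 by (simp add: R_def)
    have "R * (3 * real k1) \<le> R * (12 * L)" using k1 \<open>0 < R\<close> by (intro mult_left_mono) auto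
    also have "\<dots> < 1" using \<open>R * L = 1 / 13\<close> by simp
    finally show "R < 1 / (3 * real k1)" using k1' by (simp add: field_simps)
  qed
  have t: "1 / 2704 * (l / real n) \<le> R\<^sup>2 / 16" by (simp add: R2)
  have pos: "L > 0" "real k1 > 0" "real k2 > 0" "real n > 0" "l > 0" "s > 0"
    using L4 k1' k2' n n0 s1 by auto
  have t': "144 / (real k2)\<^sup>2 \<le> 2304 * (l / real n)"
  proof -
    have "144 / (real k2)\<^sup>2 \<le> 144 / (L\<^sup>2 / 16)" using K2 pos by (intro divide_left_mono) auto
    then show ?thesis by (simp add: L2)
  qed
  have l2: "1 \<le> l\<^sup>2" "l \<le> l\<^sup>2" using n self_le_power[of l 2] by (auto intro: one_le_power)
  have exp_l: "exp (- l) = 1 / real n" using n0 by (simp add: l_def exp_minus inverse_eq_divide)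
  have small: "1 / real n \<le> l\<^sup>2 / sqrt (real n)"
  proof -
    have "sqrt (real n) \<le> real n" using n0 by (intro real_le_lsqrt) (auto simp: power2_eq_square)
    then show ?thesis using l2 n0 by (intro frac_le) auto
  qed
  \<comment> \<open>A coarse cell expects at least \<open>2 * l\<close> points, so it is empty with
    probability at most \<open>1 / (real n)\<^sup>2\<close>, and there are at most \<open>n\<close>
    cells.\<close>
  have B1: "(real k2)\<^sup>2 * (1 - 1 / (real k2)\<^sup>2) ^ n \<le> l\<^sup>2 / sqrt (real n)"
  proof -
    have "(1 - 1 / (real k2)\<^sup>2) ^ n \<le> exp (- (real n * (1 / (real k2)\<^sup>2)))"
      using k2' by (intro power_one_minus_le_exp) auto
    also have "\<dots> \<le> exp (- (2 * l))"
    proof -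
      have "2 * l * (real k2)\<^sup>2 \<le> 2 * l * (L\<^sup>2 / 4)" using K2 n by (intro mult_left_mono) auto
      also have "\<dots> \<le> real n" using n by (simp add: L2)
      finally show ?thesis using k2' by (simp add: field_simps)
    qed
    also have "\<dots> = (1 / real n) * (1 / real n)"
      by (simp add: exp_l[symmetric] exp_add[symmetric])
    finally have "(real k2)\<^sup>2 * (1 - 1 / (real k2)\<^sup>2) ^ n \<le> real n * ((1 / real n) * (1 / real n))"
    proof (rule mult_mono[rotated])
      have "real n / l \<le> real n" using n by (simp add: divide_le_eq)
      then show "(real k2)\<^sup>2 \<le> real n" using K2 L2' unfolding L2[symmetric] by linarith
    qed (use k2' in \<open>auto simp: divide_le_eq\<close>)
    then show ?thesis using small n0 by simp
  qed
  \<comment> \<open>The exponent is at most \<open>2 * l / 9\<close>, hence at most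
    \<open>l / 4\<close>, and \<open>exp (- (l / 4))\<close> is the inverse of the fourth root
    \<open>s\<close> of \<open>n\<close>.\<close>
  have q: "1 / s \<le> q"
  proof -
    have "2 * real m * (1 / (real k1)\<^sup>2) \<le> 2 * real n * (1 / (9 * L\<^sup>2))"
      using mn K1 pos by (intro mult_mono divide_left_mono) auto
    also have "\<dots> \<le> l / 4" using n n0 by (simp add: L2 divide_simps)
    finally have "exp (- (l / 4)) \<le> exp (- (2 * real m * (1 / (real k1)\<^sup>2)))" by simp
    also have "\<dots> \<le> q"
      unfolding q_def using K1 L2' by (intro power_one_minus_ge_exp) (auto simp: divide_simps)
    finally show ?thesis by (simp add: ln_s)
  qed
  have q1: "q \<le> 1" "q > 0"
    using k1' q s1 by (auto simp: q_def divide_le_eq intro!: power_le_one order.strict_trans2[OF _ q])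
  have B2: "4 / ((real k1)\<^sup>2 * q) \<le> l\<^sup>2 / sqrt (real n)"
  proof -
    have "4 / ((real k1)\<^sup>2 * q) \<le> 4 / (9 * L\<^sup>2 * (1 / s))"
      using K1 q L2' s1 q1 k1' pos by (intro divide_left_mono mult_mono mult_pos_pos) auto
    also have "\<dots> = 4 / 9 * l * (s / real n)" using n by (simp add: L2)
    also have "\<dots> \<le> l * (s / real n)" using n s1 by (intro mult_right_mono) auto
    also have "\<dots> \<le> l\<^sup>2 * (1 / sqrt (real n))"
    proof (rule mult_mono)
      have "s * s\<^sup>2 \<le> s\<^sup>2 * s\<^sup>2" using s1 self_le_power[of s 2] by (intro mult_right_mono) auto
      then have "s * sqrt (real n) \<le> real n" by (simp add: s2)
      then show "s / real n \<le> 1 / sqrt (real n)" using pos by (simp add: field_simps)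
    qed (use l2 pos in auto)
    finally show ?thesis by simp
  qed
  \<comment> \<open>The constant 18 of the strategy cancels the 18 in \<open>q / 18\<close>, and the
    remaining exponent \<open>s * l\<close> is at least \<open>l\<close>.\<close>
  have B3: "(1 - q / 18) ^ (n - m) \<le> l\<^sup>2 / sqrt (real n)"
  proof -
    have "(1 - q / 18) ^ (n - m) \<le> exp (- (real (n - m) * (q / 18)))"
      using q1 by (intro power_one_minus_le_exp) auto
    also have "\<dots> \<le> exp (- l)"
    proof -
      have "l * 1 \<le> l * s" using n s1 by (intro mult_left_mono) auto
      also have "\<dots> = (18 * s\<^sup>2 * l) * (1 / s / 18)" using s1 by (simp add: power2_eq_square)
      also have "\<dots> \<le> real (n - m) * (q / 18)"
        using nm(1) q s1 n unfolding s2[symmetric] by (intro mult_mono divide_right_mono) auto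
      finally show ?thesis by simp
    qed
    finally show ?thesis using small by (simp add: exp_l)
  qed
  have B4: "real (n - m) * (36 * R\<^sup>2) \<le> 8 * (l\<^sup>2 / sqrt (real n))"
  proof -
    have "real (n - m) * (36 * R\<^sup>2) \<le> (36 * sqrt (real n) * l) * (36 * R\<^sup>2)"
      using nm by (intro mult_right_mono) auto
    also have "\<dots> = 1296 / 169 * (l\<^sup>2 * (sqrt (real n) / real n))"
      by (simp add: R2) (simp add: power2_eq_square mult.commute)
    also have "sqrt (real n) / real n = 1 / sqrt (real n)"
      by (simp add: sqrt_divide_self_eq inverse_eq_divide)
    also have "1296 / 169 * (l\<^sup>2 * (1 / sqrt (real n))) = 1296 / 169 * (l\<^sup>2 / sqrt (real n))"
      by simp
    also have "\<dots> \<le> 8 * (l\<^sup>2 / sqrt (real n))" by (intro mult_right_mono) auto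
    finally show ?thesis .
  qed
  \<comment> \<open>The four error terms contribute 1 + 1 + 1 + 8 = 11.\<close>
  have "1 - 11 * l\<^sup>2 / sqrt (real n) \<le> 1 - ((real k2)\<^sup>2 * (1 - 1 / (real k2)\<^sup>2) ^ n + 4 / ((real k1)\<^sup>2 * q)
      + (1 - q / 18) ^ (n - m) + real (n - m) * (36 * R\<^sup>2))"
    using B1 B2 B3 B4 by simp
  also note prob_strategy_success[OF mn k1' k2' R m_iff t t', folded q_def]
  finally show ?thesis unfolding R_def .
qed

theorem theorem4p1:
  "\<exists>c > 0. \<exists>R :: nat \<Rightarrow> real. R \<in> \<Theta>(\<lambda>n. sqrt (ln (real n) / real n)) \<and>
     (\<exists>C1 C2 C3 :: real. \<exists>N :: nat. C2 > 0 \<and> C3 > 0 \<and>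
       (\<forall>n \<ge> N.
          measure (points_space n)
            {\<omega> \<in> space (points_space n).
               (\<exists>i. strategy_pick n c (R n) \<omega> = Some i \<and>
                    cell_area (point_set n \<omega>) (\<omega> i) \<ge> C2 * (ln (real n) / real n)) \<and>
               (\<forall>j<n. cell_area (point_set n \<omega>) (\<omega> j) \<le> C3 * (ln (real n) / real n))}
          \<ge> 1 - C1 * (ln (real n))\<^sup>2 / sqrt (real n)))"
proof -
  let ?R = "\<lambda>n. sqrt (ln (real n) / real n) / 13"
  have "eventually (\<lambda>n. ln (real n) \<ge> 1 \<and> 16 * ln (real n) \<le> real n \<and>
      18 * sqrt (real n) * ln (real n) \<le> real n) at_top"
    by (intro eventually_conj; real_asymp)
  then obtain N where N: "\<And>n. n \<ge> N \<Longrightarrow> ln (real n) \<ge> 1 \<and> 16 * ln (real n) \<le> real n \<and>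
      18 * sqrt (real n) * ln (real n) \<le> real n"
    by (auto simp: eventually_at_top_linorder)
  have \<Theta>: "?R \<in> \<Theta>(\<lambda>n. sqrt (ln (real n) / real n))" by simp
  show ?thesis
    \<comment> \<open>\<open>2704 = 16 * 13\<^sup>2\<close> comes from the bound
      \<open>R\<^sup>2 / 16\<close>, and \<open>2304 = 144 * 16\<close> from
      \<open>144 / (real k2)\<^sup>2\<close> with \<open>L / 4 \<le> real k2\<close>.\<close>
    by (rule exI[of _ 18], rule conjI, simp, rule exI[of _ ?R], rule conjI[OF \<Theta>],
        rule exI[of _ 11], rule exI[of _ "1 / 2704"], rule exI[of _ 2304], rule exI[of _ N])
      (use N prob_strategy_success_asymp in auto)
qed

end
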